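(* Let $\mathbf{F}^{\alpha}$ be the graph fractional Fourier transform matrix of order $\alpha\in\mathbb{R}$ of a graph with $N$ vertices, let $\mathcal{S}\subseteq\mathcal{V}$ be a sampling set and $\mathcal{F}\subseteq\{1,\dots,N\}$ a frequency-index subset, with associated operators $\mathbf{D}$, $\overline{\mathbf{D}}=\mathbf{I}-\mathbf{D}$ and $\mathbf{B}^{\alpha}$. Given the samples $\bm{x}_{\mathcal{S}}=\mathbf{D}\bm{x}$, any $\bm{x}\in\mathcal{B}^{\alpha}$ can be perfectly recovered from its samples (i.e. there is a matrix $\mathbf{R}\in\mathbb{C}^{N\times N}$ with $\mathbf{R}\mathbf{D}\bm{x}=\bm{x}$ for all $\bm{x}\in\mathcal{B}^{\alpha}$) if and only if $$\|\mathbf{B}^{\alpha}\overline{\mathbf{D}}\|_2<1,$$ and this condition is equivalent to: the operator $\mathbf{B}^{\alpha}\overline{\mathbf{D}}$ has no eigenvector $\bm{v}$ that is fully supported on $\mathcal{S}^c=\mathcal{V}\setminus\mathcal{S}$ (i.e. $\overline{\mathbf{D}}\bm{v}=\bm{v}$) while being graph fractional bandlimited on $\mathcal{F}$ (i.e. $\mathbf{B}^{\alpha}\bm{v}=\bm{v}$).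
   Context: Let $\mathcal{G}$ be an undirected weighted graph with vertex set $\mathcal{V}$, $|\mathcal{V}|=N$; vertices are identified with the coordinates $1,\dots,N$ of $\mathbb{C}^N$. A graph signal is a vector $\bm{x}\in\mathbb{C}^N$. The graph shift operator $\mathbf{S}$ is a symmetric (Hermitian) $N\times N$ matrix (e.g. the adjacency matrix or the graph Laplacian) with eigendecomposition $\mathbf{S}=\mathbf{U}\boldsymbol{\Delta}\mathbf{U}^{\mathrm H}$, where $\boldsymbol{\Delta}$ is the diagonal matrix of eigenvalues and $\mathbf{U}$ is unitary with the eigenvectors as columns. The graph Fourier transform matrix is $\mathbf{F}=\mathbf{U}^{\mathrm H}$. Being unitary, it has a spectral decomposition $\mathbf{U}^{\mathrm H}=\mathbf{Q}\boldsymbol{\Lambda}\mathbf{Q}^{\mathrm H}$ with $\mathbf{Q}$ unitary and $\boldsymbol{\Lambda}$ diagonal with unimodular entries. For $\alpha\in\mathbb{R}$, the graph fractional Fourier transform (GFRFT) matrix is $\mathbf{F}^{\alpha}=\mathbf{Q}\boldsymbol{\Lambda}^{\alpha}\mathbf{Q}^{\mathrm H}$, where $\boldsymbol{\Lambda}^{\alpha}$ is obtained by raising each diagonal entry of $\boldsymbol{\Lambda}$ to the power $\alpha$ (with a fixed choice of argument for each entry, so $\mathbf{F}^{\alpha}$ is unitary), and $\mathbf{F}^{-\alpha}=\mathbf{Q}\boldsymbol{\Lambda}^{-\alpha}\mathbf{Q}^{\mathrm H}$ is its inverse. For $\mathcal{S}\subseteq\mathcal{V}$, $\mathbf{D}=\mathbf{D}_{\mathcal{S}}=\mathrm{diag}(\mathbf{1}_{\mathcal{S}})$,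 where $\mathbf{1}_{\mathcal{S}}$ is the indicator vector of $\mathcal{S}$. For $\mathcal{F}\subseteq\{1,\dots,N\}$, $\mathbf{B}^{\alpha}=\mathbf{B}^{\alpha}_{\mathcal{F}}=\mathbf{F}^{-\alpha}\boldsymbol{\Sigma}_{\mathcal{F}}\mathbf{F}^{\alpha}$ with $\boldsymbol{\Sigma}_{\mathcal{F}}=\mathrm{diag}(\mathbf{1}_{\mathcal{F}})$. $\mathcal{B}^{\alpha}$ denotes the set of graph fractional bandlimited signals, i.e. those $\bm{x}\in\mathbb{C}^N$ with $\mathbf{B}^{\alpha}\bm{x}=\bm{x}$. The sampled signal $\mathbf{D}\bm{x}$ keeps the entries of $\bm{x}$ on $\mathcal{S}$ and sets the others to zero; a reconstruction operator is a matrix $\mathbf{R}$ applied to the sampled signal. $\|\cdot\|_2$ of a matrix is the spectral norm. *)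

theory Defs
  imports "HOL-Analysis.Analysis"
begin

text \<open>
  A finite type \<open>'n\<close> serves both as the vertex set and as the set of frequency indices
  (each identified with \<open>1, \<dots>, N\<close>), so that \<open>N = CARD('n)\<close>. Graph signals
  are elements of \<open>complex ^ 'n\<close>, whose library norm is the Euclidean one.
\<close>

definition conj_transpose :: "complex ^ 'n ^ 'm \<Rightarrow> complex ^ 'm ^ 'n" where
  "conj_transpose A = map_matrix cnj (transpose A)"

definition hermitian :: "complex ^ 'n ^ 'n \<Rightarrow> bool" where
  "hermitian A \<longleftrightarrow> conj_transpose A = A"

definition unitary :: "complex ^ 'n ^ 'n \<Rightarrow> bool" where
  "unitary U \<longleftrightarrow> conj_transpose U ** U = mat 1 \<and> U ** conj_transpose U = mat 1"

definition diag_matrix :: "complex ^ 'n \<Rightarrow> complex ^ 'n ^ 'n" where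
  "diag_matrix d = (\<chi> i j. if i = j then d $ i else 0)"

text \<open>
  The graph is given by its matrix of edge weights, weight zero meaning that there is no edge.
\<close>

definition undirected_weighted_graph :: "real ^ 'n ^ 'n \<Rightarrow> bool" where
  "undirected_weighted_graph W \<longleftrightarrow> transpose W = W"

definition unitary_decomposition ::
    "complex ^ 'n ^ 'n \<Rightarrow> complex ^ 'n ^ 'n \<Rightarrow> complex ^ 'n \<Rightarrow> bool" where
  "unitary_decomposition S U \<delta> \<longleftrightarrow>
     unitary U \<and> S = U ** diag_matrix \<delta> ** conj_transpose U"

text \<open>
  A real power of a unimodular number depends on a choice of its argument. The choice is kept as
  a parameter \<open>\<theta>\<close>, one argument for each diagonal entry, so that
  \<open>(cis (\<theta> $ k))\<^sup>\<alpha>\<close> is \<open>cis (\<alpha> * \<theta> $ k)\<close>.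
\<close>

definition argument_choice :: "complex ^ 'n \<Rightarrow> real ^ 'n \<Rightarrow> bool" where
  "argument_choice l \<theta> \<longleftrightarrow> (\<forall>k. l $ k = cis (\<theta> $ k))"

definition gfrft :: "complex ^ 'n ^ 'n \<Rightarrow> real ^ 'n \<Rightarrow> real \<Rightarrow> complex ^ 'n ^ 'n" where
  "gfrft Q \<theta> \<alpha> = Q ** diag_matrix (\<chi> k. cis (\<alpha> * \<theta> $ k)) ** conj_transpose Q"

text \<open>
  \<open>diag (1\<^sub>A)\<close>: the sampling operator when \<open>A\<close> is a set of vertices, the frequency mask when
  \<open>A\<close> is a set of frequency indices.
\<close>

definition index_mask :: "'n set \<Rightarrow> complex ^ 'n ^ 'n" where
  "index_mask A = diag_matrix (\<chi> i. indicator A i)"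

definition bandlimiting ::
    "complex ^ 'n ^ 'n \<Rightarrow> real ^ 'n \<Rightarrow> real \<Rightarrow> 'n set \<Rightarrow> complex ^ 'n ^ 'n" where
  "bandlimiting Q \<theta> \<alpha> F = gfrft Q \<theta> (- \<alpha>) ** index_mask F ** gfrft Q \<theta> \<alpha>"

definition bandlimited ::
    "complex ^ 'n ^ 'n \<Rightarrow> real ^ 'n \<Rightarrow> real \<Rightarrow> 'n set \<Rightarrow> (complex ^ 'n) set" where
  "bandlimited Q \<theta> \<alpha> F = {x. bandlimiting Q \<theta> \<alpha> F *v x = x}"

definition spectral_norm :: "complex ^ 'n ^ 'm \<Rightarrow> real" where
  "spectral_norm A = onorm ((*v) A)"

definition eigenvector :: "complex ^ 'n ^ 'n \<Rightarrow> complex ^ 'n \<Rightarrow> bool" where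
  "eigenvector A v \<longleftrightarrow> v \<noteq> 0 \<and> (\<exists>\<mu>. A *v v = \<mu> *s v)"

end

theory Submission
  imports Defs
begin

text \<open>
  The operators \<open>B\<close> and \<open>D'\<close> are orthogonal projections on \<open>complex ^ 'n\<close>: \<open>D'\<close> because it is
  the complement of a coordinate mask, and \<open>B\<close> because it is a coordinate mask conjugated by
  the fractional transform, which is unitary (\<open>orthogonal_projection_bandlimiting\<close>). The
  obstruction to recovery is a nonzero vector fixed by both projections; it is then
  automatically an eigenvector of \<open>B ** D'\<close>, with eigenvalue 1. The three conditions are tied
  together in a cycle.

  If some \<open>R\<close> recovers every bandlimited signal, then a vector \<open>v\<close> in both ranges has \<open>D *v v = 0\<close>,
  so \<open>v = R *v (D *v v) = 0\<close>: there is no obstruction.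

  If the norm of \<open>B ** D'\<close> is at least 1, then, the unit sphere being compact, some unit vector \<open>z\<close>
  satisfies \<open>1 \<le> norm (B *v (D' *v z)) \<le> norm (D' *v z) \<le> norm z = 1\<close>. A projection preserves
  the norm of a vector only if it fixes the vector, so \<open>z\<close> is fixed by \<open>D'\<close> and by \<open>B\<close>: there is an
  obstruction (\<open>spectral_norm_ge_1_imp_common_fixed_vector\<close>).

  If the norm of \<open>B ** D'\<close> is less than 1, then \<open>mat 1 - B ** D'\<close> is injective, hence has a left
  inverse \<open>L\<close>. A bandlimited \<open>x\<close> satisfies \<open>(mat 1 - B ** D') *v x = B *v (D *v x)\<close>, whose
  right-hand side depends on the samples only, and so \<open>L ** B\<close> recovers \<open>x\<close>
  (\<open>spectral_norm_less_1_imp_recoverable\<close>).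
\<close>

section \<open>Conjugate transposes and unitary matrices\<close>

lemma conj_transpose_nth: "conj_transpose A $ i $ j = cnj (A $ j $ i)"
  by (simp add: conj_transpose_def map_matrix_def transpose_def)

lemma conj_transpose_mult: "conj_transpose (A ** B) = conj_transpose B ** conj_transpose A"
  by (simp add: vec_eq_iff conj_transpose_nth matrix_matrix_mult_def mult.commute)

lemma conj_transpose_conj_transpose [simp]: "conj_transpose (conj_transpose A) = A"
  by (simp add: vec_eq_iff conj_transpose_nth)

lemma conj_transpose_diag_matrix: "conj_transpose (diag_matrix d) = diag_matrix (\<chi> i. cnj (d $ i))"
  by (auto simp: vec_eq_iff conj_transpose_nth diag_matrix_def)

lemma diag_matrix_mult: "diag_matrix a ** diag_matrix b = diag_matrix (\<chi> i. a $ i * b $ i)"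
proof -
  have "(\<Sum>k\<in>UNIV. (if i = k then a $ i else 0) * (if k = j then b $ k else 0))
      = (if i = j then a $ i * b $ i else 0)" for i j
    by (subst sum.remove[of _ i]) (auto intro: sum.neutral)
  then show ?thesis
    by (simp add: vec_eq_iff matrix_matrix_mult_def diag_matrix_def)
qed

text \<open>
  The inner product here is the real one on \<open>complex ^ 'n\<close>, that is, the real part of the
  Hermitian one. It induces the same norm, and the conjugate transpose is the adjoint for it as
  well, so that Euclidean geometry applies to complex matrices directly.
\<close>

lemma inner_conj_transpose:
  fixes A :: "complex ^ 'n ^ 'm"
  shows "(A *v x) \<bullet> y = x \<bullet> (conj_transpose A *v y)"
proof -
  have adjoint: "(a * b) \<bullet> c = b \<bullet> (cnj a * c)" for a b c :: complex
    by (simp add: inner_complex_def algebra_simps)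
  have "(A *v x) \<bullet> y = (\<Sum>i\<in>UNIV. \<Sum>j\<in>UNIV. x $ j \<bullet> (cnj (A $ i $ j) * y $ i))"
    by (simp add: inner_vec_def matrix_vector_mult_def inner_sum_left adjoint)
  also have "\<dots> = (\<Sum>j\<in>UNIV. \<Sum>i\<in>UNIV. x $ j \<bullet> (cnj (A $ i $ j) * y $ i))"
    by (rule sum.swap)
  also have "\<dots> = x \<bullet> (conj_transpose A *v y)"
    by (simp add: inner_vec_def matrix_vector_mult_def conj_transpose_nth inner_sum_right)
  finally show ?thesis .
qed

lemma unitary_mult:
  assumes "unitary G" and "unitary H"
  shows "unitary (G ** H)"
proof -
  have "conj_transpose H ** conj_transpose G ** (G ** H)
      = conj_transpose H ** (conj_transpose G ** G) ** H"
    and "G ** H ** (conj_transpose H ** conj_transpose G)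
      = G ** (H ** conj_transpose H) ** conj_transpose G"
    by (simp_all only: matrix_mul_assoc)
  then show ?thesis
    using assms by (simp add: unitary_def conj_transpose_mult)
qed

section \<open>Orthogonal projections\<close>

definition orthogonal_projection :: "complex ^ 'n ^ 'n \<Rightarrow> bool" where
  "orthogonal_projection P \<longleftrightarrow> hermitian P \<and> P ** P = P"

lemma projection_norm_Pythagoras:
  assumes "orthogonal_projection P"
  shows "(norm x)\<^sup>2 = (norm (P *v x))\<^sup>2 + (norm (x - P *v x))\<^sup>2"
proof -
  have idem: "P *v (P *v x) = P *v x"
    using assms by (simp add: orthogonal_projection_def matrix_vector_mul_assoc)
  have "(P *v x) \<bullet> (x - P *v x) = x \<bullet> (P *v (x - P *v x))"
    using inner_conj_transpose[of P x "x - P *v x"] assms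
    by (simp add: orthogonal_projection_def hermitian_def)
  also have "\<dots> = 0"
    by (simp add: matrix_vector_mult_diff_distrib idem)
  finally have "(norm (P *v x + (x - P *v x)))\<^sup>2 = (norm (P *v x))\<^sup>2 + (norm (x - P *v x))\<^sup>2"
    by (rule norm_add_Pythagorean[unfolded orthogonal_def])
  then show ?thesis
    by simp
qed

lemma projection_norm_le:
  assumes "orthogonal_projection P"
  shows "norm (P *v x) \<le> norm x"
  by (rule power2_le_imp_le) (simp_all add: projection_norm_Pythagoras[OF assms, of x])

text \<open>
  By Pythagoras, the residual \<open>x - P *v x\<close> accounts for all of the norm that \<open>P\<close> removes from \<open>x\<close>.
\<close>

lemma projection_fixes_if_norm_ge:
  assumes "orthogonal_projection P" and "norm x \<le> norm (P *v x)"
  shows "P *v x = x"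
proof -
  have "(norm x)\<^sup>2 \<le> (norm (P *v x))\<^sup>2"
    using assms(2) by (simp add: power_mono)
  then have "(norm (x - P *v x))\<^sup>2 \<le> 0"
    using projection_norm_Pythagoras[OF assms(1), of x] by linarith
  then show ?thesis
    by simp
qed

lemma orthogonal_projection_complement:
  assumes "orthogonal_projection P"
  shows "orthogonal_projection (mat 1 - P)"
proof -
  have "P *v (P *v x) = P *v x" for x
    using assms by (simp add: orthogonal_projection_def matrix_vector_mul_assoc)
  then have "(mat 1 - P) ** (mat 1 - P) = mat 1 - P"
    by (simp add: matrix_eq matrix_vector_mult_diff_distrib matrix_vector_mult_diff_rdistrib
        flip: matrix_vector_mul_assoc)
  moreover have "conj_transpose (mat 1 - P) = mat 1 - conj_transpose P"
    by (simp add: vec_eq_iff conj_transpose_nth mat_def)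
  ultimately show ?thesis
    using assms by (simp add: orthogonal_projection_def hermitian_def)
qed

lemma orthogonal_projection_index_mask: "orthogonal_projection (index_mask A)"
  unfolding orthogonal_projection_def hermitian_def index_mask_def
    conj_transpose_diag_matrix diag_matrix_mult
  by (simp add: diag_matrix_def vec_eq_iff indicator_def)

lemma orthogonal_projection_unitary_conjugate:
  assumes "orthogonal_projection P" and "unitary G"
  shows "orthogonal_projection (conj_transpose G ** P ** G)"
proof -
  have "(conj_transpose G ** P ** G) ** (conj_transpose G ** P ** G)
      = conj_transpose G ** (P ** (G ** conj_transpose G) ** P) ** G"
    by (simp only: matrix_mul_assoc)
  also have "\<dots> = conj_transpose G ** P ** G"
    using assms by (simp add: orthogonal_projection_def unitary_def)
  finally show ?thesis
    using assms(1)
    by (simp add: orthogonal_projection_def hermitian_def conj_transpose_mult matrix_mul_assoc)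
qed

section \<open>The bandlimiting operator\<close>

text \<open>
  Conjugating \<open>cis t\<close> negates \<open>t\<close>. Thus the order \<open>- \<alpha>\<close> in the bandlimiting operator makes it a
  conjugate of the frequency mask by a unitary matrix.
\<close>

lemma conj_transpose_gfrft: "conj_transpose (gfrft Q \<theta> \<alpha>) = gfrft Q \<theta> (- \<alpha>)"
proof -
  have "conj_transpose (diag_matrix (\<chi> k. cis (\<alpha> * \<theta> $ k))) = diag_matrix (\<chi> k. cis (- \<alpha> * \<theta> $ k))"
    by (simp add: conj_transpose_diag_matrix cis_cnj)
  then show ?thesis
    by (simp add: gfrft_def conj_transpose_mult matrix_mul_assoc)
qed

lemma unitary_gfrft:
  assumes "unitary Q"
  shows "unitary (gfrft Q \<theta> \<alpha>)"
proof -
  have "unitary (diag_matrix (\<chi> k. cis (\<alpha> * \<theta> $ k)))"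
    by (simp add: unitary_def conj_transpose_diag_matrix diag_matrix_mult cis_cnj cis_mult)
      (simp add: diag_matrix_def mat_def vec_eq_iff)
  moreover have "unitary (conj_transpose Q)"
    using assms by (simp add: unitary_def)
  ultimately show ?thesis
    unfolding gfrft_def using assms by (intro unitary_mult)
qed

lemma orthogonal_projection_bandlimiting:
  assumes "unitary Q"
  shows "orthogonal_projection (bandlimiting Q \<theta> \<alpha> F)"
  unfolding bandlimiting_def conj_transpose_gfrft[symmetric]
  by (intro orthogonal_projection_unitary_conjugate orthogonal_projection_index_mask
      unitary_gfrft assms)

section \<open>The spectral norm of a product of two projections\<close>

lemma spectral_norm_attained:
  fixes A :: "complex ^ 'n ^ 'm"
  obtains z where "norm z = 1" and "spectral_norm A = norm (A *v z)"
proof -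
  interpret A: bounded_linear "(*v) A"
    by (rule matrix_vector_mul_bounded_linear)
  have "continuous_on (sphere 0 1) (\<lambda>x. norm (A *v x))"
    by (intro continuous_on_norm A.continuous_on continuous_on_id)
  moreover have "sphere (0 :: complex ^ 'n) 1 \<noteq> {}"
    by simp
  ultimately obtain z :: "complex ^ 'n" where z: "norm z = 1"
    and max: "\<And>x. norm x = 1 \<Longrightarrow> norm (A *v x) \<le> norm (A *v z)"
    using continuous_attains_sup[OF compact_sphere] by (metis mem_sphere_0)
  have "norm (A *v x) \<le> norm (A *v z) * norm x" for x
  proof (cases "x = 0")
    case False
    then have "norm (A *v (x /\<^sub>R norm x)) \<le> norm (A *v z)"
      by (intro max) simp
    with False show ?thesis
      by (simp add: A.scaleR field_simps)
  qed (simp add: A.zero)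
  then have "onorm ((*v) A) \<le> norm (A *v z)"
    by (intro onorm_bound) auto
  moreover have "norm (A *v z) \<le> onorm ((*v) A)"
    using onorm[OF A.bounded_linear_axioms, of z] z by simp
  ultimately show ?thesis
    using z that by (simp add: spectral_norm_def)
qed

text \<open>
  At a unit vector \<open>z\<close> where the norm of \<open>P ** E\<close> is attained, neither of the contractions \<open>E\<close> and
  \<open>P\<close> can shorten its argument, so each of them fixes \<open>z\<close>. Attainment is essential: it is what
  turns a norm equal to 1 into an actual vector.
\<close>

lemma spectral_norm_ge_1_imp_common_fixed_vector:
  assumes P: "orthogonal_projection P" and E: "orthogonal_projection E"
    and ge: "1 \<le> spectral_norm (P ** E)"
  obtains v where "v \<noteq> 0" and "P *v v = v" and "E *v v = v"
proof -
  obtain z where z: "norm z = 1" "spectral_norm (P ** E) = norm (P *v (E *v z))"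
    by (metis spectral_norm_attained matrix_vector_mul_assoc)
  have "norm z \<le> norm (E *v z)"
    using projection_norm_le[OF P, of "E *v z"] z ge by simp
  then have Ez: "E *v z = z"
    by (rule projection_fixes_if_norm_ge[OF E])
  have "P *v z = z"
    using z ge Ez by (intro projection_fixes_if_norm_ge[OF P]) simp
  moreover from z have "z \<noteq> 0"
    by auto
  ultimately show ?thesis
    using Ez that by blast
qed

text \<open>
  The sum of the Neumann series of \<open>A\<close> would be such an inverse; in finite dimension it is
  enough that a vector killed by \<open>mat 1 - A\<close> is fixed by \<open>A\<close>, which strictly shortens every
  nonzero vector.
\<close>

lemma spectral_norm_less_1_imp_left_inverse:
  fixes A :: "complex ^ 'n ^ 'n"
  assumes "spectral_norm A < 1"
  obtains L where "L ** (mat 1 - A) = mat 1"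
proof -
  have "y = 0" if "(mat 1 - A) *v y = 0" for y
  proof (rule ccontr)
    assume "y \<noteq> 0"
    have "norm y = norm (A *v y)"
      using that by (simp add: matrix_vector_mult_diff_rdistrib)
    also have "\<dots> \<le> spectral_norm A * norm y"
      unfolding spectral_norm_def by (rule onorm[OF matrix_vector_mul_bounded_linear])
    also have "\<dots> < norm y"
      using assms \<open>y \<noteq> 0\<close> by simp
    finally show False
      by simp
  qed
  then show ?thesis
    using that matrix_left_invertible_ker by blast
qed

text \<open>
  For \<open>x\<close> fixed by \<open>P\<close>, the unsampled part \<open>(mat 1 - D) *v x\<close> contributes
  \<open>P *v ((mat 1 - D) *v x) = x - P *v (D *v x)\<close>. Hence \<open>x\<close> solves a linear
  equation with data \<open>P *v (D *v x)\<close>, and inverting \<open>mat 1 - P ** (mat 1 - D)\<close> solves it.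
\<close>

lemma spectral_norm_less_1_imp_recoverable:
  fixes P D :: "complex ^ 'n ^ 'n"
  assumes "spectral_norm (P ** (mat 1 - D)) < 1"
  obtains R where "\<And>x. P *v x = x \<Longrightarrow> R *v (D *v x) = x"
proof -
  obtain L where L: "L ** (mat 1 - P ** (mat 1 - D)) = mat 1"
    using spectral_norm_less_1_imp_left_inverse[OF assms] .
  show ?thesis
  proof (rule that[of "L ** P"])
    fix x
    assume x: "P *v x = x"
    have "(mat 1 - P ** (mat 1 - D)) *v x = P *v (D *v x)"
      by (simp add: matrix_vector_mult_diff_rdistrib matrix_vector_mult_diff_distrib x
          flip: matrix_vector_mul_assoc)
    then have "(L ** P) *v (D *v x) = (L ** (mat 1 - P ** (mat 1 - D))) *v x"
      by (simp flip: matrix_vector_mul_assoc)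
    then show "(L ** P) *v (D *v x) = x"
      by (simp add: L)
  qed
qed

section \<open>Perfect recovery from samples\<close>

theorem theorem2:
  fixes W :: "real ^ 'n ^ 'n"
    and S U Q B D D' :: "complex ^ 'n ^ 'n"
    and \<delta> l :: "complex ^ 'n"
    and \<theta> :: "real ^ 'n"
    and \<alpha> :: real
    and \<S> \<F> :: "'n set"
  assumes graph: "undirected_weighted_graph W"
    and shift: "hermitian S"
    and shift_decomposition: "unitary_decomposition S U \<delta>"
    and gft_decomposition: "unitary_decomposition (conj_transpose U) Q l"
    and arguments: "argument_choice l \<theta>"
  defines "B \<equiv> bandlimiting Q \<theta> \<alpha> \<F>"
    and "D \<equiv> index_mask \<S>"
    and "D' \<equiv> mat 1 - D"
  shows "((\<exists>R :: complex ^ 'n ^ 'n. \<forall>x \<in> bandlimited Q \<theta> \<alpha> \<F>. R *v (D *v x) = x)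
            \<longleftrightarrow> spectral_norm (B ** D') < 1)
       \<and> (spectral_norm (B ** D') < 1
            \<longleftrightarrow> \<not> (\<exists>v. eigenvector (B ** D') v \<and> D' *v v = v \<and> B *v v = v))"
    (is "(?recoverable \<longleftrightarrow> ?norm) \<and> (?norm \<longleftrightarrow> \<not> ?obstruction)")
proof -
  have B: "orthogonal_projection B"
    using gft_decomposition unfolding B_def unitary_decomposition_def
    by (blast intro: orthogonal_projection_bandlimiting)
  have D': "orthogonal_projection D'"
    unfolding D'_def D_def
    by (intro orthogonal_projection_complement orthogonal_projection_index_mask)
  have "\<not> ?obstruction" if ?recoverable
  proof
    from that obtain R where R: "\<And>x. B *v x = x \<Longrightarrow> R *v (D *v x) = x"
      unfolding bandlimited_def B_def by blast
    assume ?obstruction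
    then obtain v where "v \<noteq> 0" and D'v: "D' *v v = v" and Bv: "B *v v = v"
      by (auto simp: eigenvector_def)
    from D'v have "D *v v = 0"
      by (simp add: D'_def matrix_vector_mult_diff_rdistrib)
    with R[OF Bv] \<open>v \<noteq> 0\<close> show False
      by simp
  qed
  moreover have ?norm if "\<not> ?obstruction"
  proof (rule ccontr)
    assume "\<not> ?norm"
    then obtain v where v: "v \<noteq> 0" "B *v v = v" "D' *v v = v"
      using spectral_norm_ge_1_imp_common_fixed_vector[OF B D'] by (metis not_less)
    then have "(B ** D') *v v = 1 *s v"
      by (simp flip: matrix_vector_mul_assoc)
    with v that show False
      unfolding eigenvector_def by blast
  qed
  moreover have ?recoverable if ?norm
  proof -
    from that obtain R where "\<And>x. B *v x = x \<Longrightarrow> R *v (D *v x) = x"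
      unfolding D'_def by (rule spectral_norm_less_1_imp_recoverable) blast
    then show ?recoverable
      unfolding bandlimited_def B_def by auto
  qed
  ultimately show ?thesis
    by blast
qed

end
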